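(* There is an absolute constant $K>0$ such that the following holds. Let $\mathcal{C}\subset\mathbb{R}^n$ be a compact convex set with $\ell_2$-diameter $D_2=\max_{x,y\in\mathcal{C}}\|x-y\|_2>0$, $x^*\in\mathcal{C}$, $\epsilon>0$, and $f(x)=\|x-x^*\|_\infty$ for $x\in\mathbb{R}^n$. Run the HCGS (Hybrid Conditional Gradient-Smoothing) algorithm on $\min_{x\in\mathcal{C}}f(x)$, started at an arbitrary vertex of $\mathcal{C}$, with step sizes $\gamma_t=\frac{2}{t+2}$ and smoothing parameters $\beta_t=\frac{2D_2}{\sqrt{t+2}}$ for all $t\in\mathbb{N}$. Then the algorithm produces an iterate $x\in\mathcal{C}$ satisfying $\|x-x^*\|_\infty\leq\epsilon$ whose cardinality is $\mathcal{O}(D_2^2/\epsilon^2)$, i.e. at most $K\max\{1,D_2^2/\epsilon^2\}$.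
   Context: $\langle\cdot,\cdot\rangle$ is the Euclidean inner product on $\mathbb{R}^n$. Vertices of $\mathcal{C}$ are its extreme points. For a convex continuous $f\colon\mathbb{R}^n\to\mathbb{R}$ and $\beta>0$, the Moreau envelope is $f_\beta(x)=\min_{y\in\mathbb{R}^n}f(y)+\frac{1}{2\beta}\|x-y\|_2^2$; it is convex and differentiable with $\nabla f_\beta(x)=\frac1\beta(x-\operatorname{prox}_{\beta f}(x))$, where $\operatorname{prox}_{g}(x)=\arg\min_{y\in\mathbb{R}^n}g(y)+\frac12\|x-y\|_2^2$. HCGS: start at a vertex $x_0$ of $\mathcal{C}$; for $t=0,1,2,\ldots$ let $v_t$ be a vertex of $\mathcal{C}$ belonging to $\arg\min_{v\in\mathcal{C}}\langle v,\nabla f_{\beta_t}(x_t)\rangle$, and set $x_{t+1}=x_t+\gamma_t(v_t-x_t)$. Each iterate $x_{t+1}=(1-\gamma_t)x_t+\gamma_tv_t$ comes with an explicit convex decomposition over $x_0,v_0,\ldots,v_t$. The cardinality of an iterate is the number of distinct vertices with positive weight in this decomposition. *)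

theory Defs
  imports "HOL-Analysis.Analysis" "HOL-Library.Function_Algebras"
begin

text \<open>
  The constant of the theorem must not depend on the dimension \<open>n\<close>, so \<open>n\<close> has to be quantified inside
  the formula. Hence \<open>\<real>\<^sup>n\<close> is \<^term>\<open>topspace (Euclidean_space n)\<close>: the sequences
  \<^typ>\<open>nat \<Rightarrow> real\<close> that vanish at all indices \<open>i \<ge> n\<close>, with the topology of coordinatewise
  convergence. With the pointwise vector space structure below, \<^const>\<open>convex\<close> and
  \<^const>\<open>extreme_point_of\<close> apply to subsets of \<open>\<real>\<^sup>n\<close>. The metric that the library puts
  on \<^typ>\<open>nat \<Rightarrow> real\<close> is a different one and is not used; the Euclidean norm of \<open>x \<in> \<real>\<^sup>n\<close> is
  \<^term>\<open>L2_set x {..<n}\<close>.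
\<close>

instantiation "fun" :: (type, real_vector) real_vector
begin

definition scaleR_fun_def: "c *\<^sub>R f = (\<lambda>x. c *\<^sub>R f x)"

instance
  by standard
    (simp_all add: scaleR_fun_def plus_fun_def scaleR_add_right scaleR_add_left)

end

abbreviation rn :: "nat \<Rightarrow> (nat \<Rightarrow> real) set"
  where "rn n \<equiv> topspace (Euclidean_space n)"

definition rn_inner :: "nat \<Rightarrow> (nat \<Rightarrow> real) \<Rightarrow> (nat \<Rightarrow> real) \<Rightarrow> real"
  where "rn_inner n x y = (\<Sum>i<n. x i * y i)"

text \<open>For \<open>n = 0\<close> the maximum is over the empty set, hence unspecified.\<close>

definition linf_norm :: "nat \<Rightarrow> (nat \<Rightarrow> real) \<Rightarrow> real"
  where "linf_norm n x = Max ((\<lambda>i. \<bar>x i\<bar>) ` {..<n})"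

definition l2_diameter :: "nat \<Rightarrow> (nat \<Rightarrow> real) set \<Rightarrow> real"
  where "l2_diameter n C = (SUP (x, y)\<in>C \<times> C. L2_set (x - y) {..<n})"

text \<open>
  \<open>g\<close> is the Frechet gradient at \<open>x\<close> of \<open>F\<close> restricted to \<open>\<real>\<^sup>n\<close>. The increments \<open>h\<close> range over
  \<open>\<real>\<^sup>n\<close> only, and on \<open>\<real>\<^sup>n\<close> coordinatewise convergence is convergence in norm.
\<close>

definition has_gradient :: "nat \<Rightarrow> ((nat \<Rightarrow> real) \<Rightarrow> real) \<Rightarrow> (nat \<Rightarrow> real) \<Rightarrow> (nat \<Rightarrow> real) \<Rightarrow> bool"
  where "has_gradient n F x g \<longleftrightarrow> g \<in> rn n \<and>
    ((\<lambda>h. (F (x + h) - F x - rn_inner n g h) / L2_set h {..<n}) \<longlongrightarrow> 0) (at 0 within rn n)"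

definition gradient :: "nat \<Rightarrow> ((nat \<Rightarrow> real) \<Rightarrow> real) \<Rightarrow> (nat \<Rightarrow> real) \<Rightarrow> (nat \<Rightarrow> real)"
  where "gradient n F x = (THE g. has_gradient n F x g)"

definition moreau_envelope ::
  "nat \<Rightarrow> ((nat \<Rightarrow> real) \<Rightarrow> real) \<Rightarrow> real \<Rightarrow> (nat \<Rightarrow> real) \<Rightarrow> real"
  where "moreau_envelope n f \<beta> x =
    (INF y\<in>rn n. f y + 1 / (2 * \<beta>) * (L2_set (x - y) {..<n})\<^sup>2)"

text \<open>
  \<open>x\<close> and \<open>v\<close> are the iterates and the chosen vertices of a run; any choice of the initial vertex
  and of the minimizing vertices is allowed.
\<close>

definition hcgs_run :: "nat \<Rightarrow> (nat \<Rightarrow> real) set \<Rightarrow> ((nat \<Rightarrow> real) \<Rightarrow> real) \<Rightarrow>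
    (nat \<Rightarrow> real) \<Rightarrow> (nat \<Rightarrow> real) \<Rightarrow> (nat \<Rightarrow> nat \<Rightarrow> real) \<Rightarrow> (nat \<Rightarrow> nat \<Rightarrow> real) \<Rightarrow> bool"
  where "hcgs_run n C f \<gamma> \<beta> x v \<longleftrightarrow>
    x 0 extreme_point_of C \<and>
    (\<forall>t. v t extreme_point_of C \<and>
         is_arg_min (\<lambda>u. rn_inner n u (gradient n (moreau_envelope n f (\<beta> t)) (x t)))
           (\<lambda>u. u \<in> C) (v t) \<and>
         x (Suc t) = x t + \<gamma> t *\<^sub>R (v t - x t))"

text \<open>
  \<open>hcgs_weight \<gamma> x0 v t u\<close> is the total weight of the vertex \<open>u\<close> in the decomposition of the
  \<open>t\<close>-th iterate over \<open>x0, v 0, \<dots>, v (t - 1)\<close> obtained by unrolling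
  \<open>x (Suc t) = (1 - \<gamma> t) x t + \<gamma> t v t\<close>; the weights of repeated vertices are added up.
\<close>

primrec hcgs_weight :: "(nat \<Rightarrow> real) \<Rightarrow> 'a \<Rightarrow> (nat \<Rightarrow> 'a) \<Rightarrow> nat \<Rightarrow> 'a \<Rightarrow> real"
  where
    "hcgs_weight \<gamma> x0 v 0 u = (if u = x0 then 1 else 0)"
  | "hcgs_weight \<gamma> x0 v (Suc t) u =
       (1 - \<gamma> t) * hcgs_weight \<gamma> x0 v t u + (if u = v t then \<gamma> t else 0)"

definition hcgs_cardinality :: "(nat \<Rightarrow> real) \<Rightarrow> 'a \<Rightarrow> (nat \<Rightarrow> 'a) \<Rightarrow> nat \<Rightarrow> nat"
  where "hcgs_cardinality \<gamma> x0 v t = card {u. hcgs_weight \<gamma> x0 v t u > 0}"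

lemma hcgs_weight_outside:
  "u \<notin> insert x0 (v ` {..<t}) \<Longrightarrow> hcgs_weight \<gamma> x0 v t u = 0"
  by (induction t) (auto simp: lessThan_Suc)

lemma finite_hcgs_support: "finite {u. hcgs_weight \<gamma> x0 v t u > 0}"
  by (rule finite_subset[of _ "insert x0 (v ` {..<t})"])
    (use hcgs_weight_outside[of _ x0 v t \<gamma>] in force)+

lemma hcgs_decomposition:
  fixes x :: "nat \<Rightarrow> 'a::real_vector"
  assumes step: "\<And>t. x (Suc t) = x t + \<gamma> t *\<^sub>R (v t - x t)"
    and fin: "finite S" and sub: "insert (x 0) (v ` {..<t}) \<subseteq> S"
  shows "x t = (\<Sum>u\<in>S. hcgs_weight \<gamma> (x 0) v t u *\<^sub>R u)"
  using sub
proof (induction t)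
  case 0
  then have "(\<Sum>u\<in>S. hcgs_weight \<gamma> (x 0) v 0 u *\<^sub>R u) = (\<Sum>u\<in>S. if u = x 0 then u else 0)"
    by (intro sum.cong) auto
  with 0 fin show ?case by simp
next
  case (Suc t)
  have "(\<Sum>u\<in>S. hcgs_weight \<gamma> (x 0) v (Suc t) u *\<^sub>R u) =
     (\<Sum>u\<in>S. (1 - \<gamma> t) *\<^sub>R (hcgs_weight \<gamma> (x 0) v t u *\<^sub>R u) + (if u = v t then \<gamma> t *\<^sub>R u else 0))"
    by (intro sum.cong) (auto simp: algebra_simps)
  also have "\<dots> = (1 - \<gamma> t) *\<^sub>R x t + \<gamma> t *\<^sub>R v t"
    using Suc fin by (simp add: sum.distrib scaleR_sum_right lessThan_Suc)
  also have "\<dots> = x (Suc t)"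
    unfolding step[of t] by (simp add: algebra_simps)
  finally show ?case by (rule sym)
qed

end

theory Submission
  imports Defs
begin

text \<open>
  Let \<open>F \<beta>\<close> be the Moreau envelope of a convex function \<open>f\<close> that is \<open>G\<close>-Lipschitz for the Euclidean
  norm; for \<open>f y = \<parallel>y - x\<^sup>*\<parallel>\<^sub>\<infinity>\<close> one may take \<open>G = 1\<close>. A proximal point \<open>p\<close> of \<open>x\<close> exists, and
  \<open>(x - p) / \<beta>\<close> is a subgradient of \<open>f\<close> at \<open>p\<close> (\<open>prox_subgradient\<close>). This makes \<open>F \<beta>\<close> lie between
  an affine function and the same function plus \<open>\<parallel>y - x\<parallel>\<^sup>2 / (2 \<beta>)\<close>
  (\<open>moreau_envelope_quadratic_bounds\<close>), which identifies its gradient and gives at once the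
  convexity and the smoothness on which conditional gradient steps rely. The subgradient is bounded
  by \<open>G\<close>, hence \<open>\<parallel>x - p\<parallel> \<le> \<beta> G\<close>; this controls both the gap \<open>f - F \<beta> \<le> \<beta> G\<^sup>2 / 2\<close> and the growth of
  \<open>F \<beta>\<close> when \<open>\<beta>\<close> decreases.

  Put \<open>h t = F (\<beta> t) (x t) - f y\<close> for a fixed \<open>y \<in> C\<close> and \<open>s = t + 2\<close>. One step multiplies \<open>h\<close> by
  \<open>1 - 2 / s\<close>, up to an error \<open>D / s\<^bsup>3/2\<^esup>\<close> from the curvature of the envelope, and
  changing the smoothing parameter costs at most \<open>G\<^sup>2 D / s\<^bsup>3/2\<^esup>\<close>. Such a recursion gives
  \<open>h (t + 1) \<le> (1 + G\<^sup>2) D / \<surd>s\<close> (\<open>le_inverse_sqrt_if_recursion\<close>). Together with the smoothing gap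
  this yields \<open>f (x (t + 1)) - f y \<le> (1 + 2 G\<^sup>2) D / \<surd>s\<close> (\<open>hcgs_convergence\<close>). With \<open>G = 1\<close> and
  \<open>y = x\<^sup>*\<close>, accuracy \<open>\<epsilon>\<close> is reached after about \<open>9 D\<^sup>2 / \<epsilon>\<^sup>2\<close> steps, and each step adds at most one
  vertex to the decomposition. No estimate depends on the dimension.
\<close>

section \<open>Euclidean geometry of finitely supported sequences\<close>

lemma rn_closed:
  "0 \<in> rn n"
  "x \<in> rn n \<Longrightarrow> y \<in> rn n \<Longrightarrow> x + y \<in> rn n"
  "x \<in> rn n \<Longrightarrow> y \<in> rn n \<Longrightarrow> x - y \<in> rn n"
  "x \<in> rn n \<Longrightarrow> c *\<^sub>R x \<in> rn n"
  by (auto simp: topspace_Euclidean_space scaleR_fun_def)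

lemma convex_rn: "convex (rn n)"
  by (simp add: convex_def rn_closed)

lemma rn_inner_commute: "rn_inner n x y = rn_inner n y x"
  by (simp add: rn_inner_def mult.commute)

lemma rn_inner_simps:
  "rn_inner n (x + y) z = rn_inner n x z + rn_inner n y z"
  "rn_inner n (x - y) z = rn_inner n x z - rn_inner n y z"
  "rn_inner n (c *\<^sub>R x) z = c * rn_inner n x z"
  "rn_inner n z (x + y) = rn_inner n z x + rn_inner n z y"
  "rn_inner n z (x - y) = rn_inner n z x - rn_inner n z y"
  "rn_inner n z (c *\<^sub>R x) = c * rn_inner n z x"
  by (simp_all add: rn_inner_def scaleR_fun_def algebra_simps sum.distrib
      sum_subtractf sum_distrib_left)

lemma L2_set_power2: "(L2_set x {..<n})\<^sup>2 = rn_inner n x x"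
  by (simp add: L2_set_def rn_inner_def power2_eq_square sum_nonneg)

lemma L2_set_eq_0_rn:
  assumes "x \<in> rn n"
  shows "L2_set x {..<n} = 0 \<longleftrightarrow> x = 0"
proof
  assume "L2_set x {..<n} = 0"
  then have "x i = 0" if "i < n" for i
    using that by (simp add: L2_set_eq_0_iff)
  moreover have "x i = 0" if "\<not> i < n" for i
    using that assms by (simp add: topspace_Euclidean_space)
  ultimately show "x = 0"
    unfolding fun_eq_iff zero_fun_apply by blast
qed (simp add: L2_set_0')

lemma L2_set_scaleR: "L2_set (c *\<^sub>R x) {..<n} = \<bar>c\<bar> * L2_set x {..<n}"
proof -
  have "L2_set (c *\<^sub>R x) {..<n} = L2_set (\<lambda>i. \<bar>c\<bar> * x i) {..<n}"
    by (simp add: L2_set_def scaleR_fun_def power_mult_distrib)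
  then show ?thesis
    by (simp add: L2_set_right_distrib)
qed

lemma L2_set_minus_commute: "L2_set (x - y) {..<n} = L2_set (y - x) {..<n}"
  by (simp add: L2_set_def power2_commute)

lemma continuous_on_L2_set [continuous_intros]:
  fixes f :: "'a::topological_space \<Rightarrow> nat \<Rightarrow> real"
  assumes "continuous_on S f"
  shows "continuous_on S (\<lambda>z. L2_set (f z) {..<n})"
  using continuous_on_product_then_coordinatewise[OF assms]
  unfolding L2_set_def by (intro continuous_on_real_sqrt continuous_on_sum continuous_on_power)

lemma continuous_on_diff_fun:
  fixes f :: "'a::topological_space \<Rightarrow> nat \<Rightarrow> real"
  assumes "continuous_on S f" "continuous_on S g"
  shows "continuous_on S (\<lambda>z. f z - g z)"
  using continuous_on_product_then_coordinatewise[OF assms(1)]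
    continuous_on_product_then_coordinatewise[OF assms(2)]
  unfolding fun_diff_def
  by (intro continuous_on_coordinatewise_then_product continuous_on_diff)

text \<open>Compactness bounds the distances, so that the supremum in the diameter is not a default value.\<close>

lemma L2_set_le_l2_diameter:
  assumes C: "compact C" and "x \<in> C" "y \<in> C"
  shows "L2_set (x - y) {..<n} \<le> l2_diameter n C"
proof -
  have "continuous_on (C \<times> C) (\<lambda>z. L2_set (fst z - snd z) {..<n})"
    by (intro continuous_on_L2_set continuous_on_diff_fun continuous_intros)
  then have "compact ((\<lambda>z. L2_set (fst z - snd z) {..<n}) ` (C \<times> C))"
    using C by (intro compact_continuous_image compact_Times)
  then have "bdd_above ((\<lambda>(x, y). L2_set (x - y) {..<n}) ` (C \<times> C))"
    by (simp add: case_prod_unfold compact_imp_bounded bounded_imp_bdd_above)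
  then have "(case (x, y) of (x, y) \<Rightarrow> L2_set (x - y) {..<n}) \<le> l2_diameter n C"
    unfolding l2_diameter_def using assms by (intro cSUP_upper) auto
  then show ?thesis
    by simp
qed

text \<open>
  The box consists of all points of \<open>\<real>\<^sup>n\<close> at maximum-norm distance at most \<open>R\<close> from \<open>x\<close>. It serves as
  the compact set on which the proximal objective attains its minimum.
\<close>

lemma compact_box_rn:
  fixes x :: "nat \<Rightarrow> real"
  shows "compact {y. \<forall>i. y i \<in> (if i < n then cball (x i) R else {0::real})}"
proof -
  let ?S = "\<lambda>i. if i < n then cball (x i) R else {0::real}"
  have 0: "compact (?S i)" for i
    by simp
  have "\<forall>i\<in>UNIV. compactin euclidean (?S i)"
    unfolding compactin_euclidean_iff using 0 by blast
  then have "compactin (product_topology (\<lambda>i::nat. euclidean) UNIV) (PiE UNIV ?S)"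
    by (intro iffD2[OF compactin_PiE] disjI2)
  then have "compact (PiE UNIV ?S)"
    unfolding euclidean_product_topology compactin_euclidean_iff .
  moreover have "PiE UNIV ?S = {y. \<forall>i. y i \<in> ?S i}"
    unfolding PiE_UNIV_domain Pi_def by blast
  ultimately show ?thesis
    by (rule back_subst)
qed

section \<open>Gradients\<close>

text \<open>
  The difference \<open>d\<close> of two gradients satisfies \<open>\<langle>d, h\<rangle> = o(\<parallel>h\<parallel>)\<close>. Along \<open>h = s d\<close> with \<open>s\<close> decreasing
  to \<open>0\<close> the quotient is constantly \<open>\<parallel>d\<parallel>\<close>, so \<open>d = 0\<close>.
\<close>

lemma gradient_eqI:
  assumes g: "has_gradient n F x g"
  shows "gradient n F x = g"
  unfolding gradient_def
proof (rule the_equality)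
  show "has_gradient n F x g"
    by (rule g)
next
  fix g' assume g': "has_gradient n F x g'"
  define d where "d = g' - g"
  have d: "d \<in> rn n"
    using g g' by (auto simp: d_def has_gradient_def intro: rn_closed)
  show "g' = g"
  proof (rule ccontr)
    assume "g' \<noteq> g"
    then have "d \<noteq> 0"
      by (simp add: d_def)
    then have pos: "L2_set d {..<n} > 0"
      using L2_set_eq_0_rn[OF d] by (simp add: less_le)
    have "((\<lambda>h. (F (x + h) - F x - rn_inner n g h) / L2_set h {..<n} -
        (F (x + h) - F x - rn_inner n g' h) / L2_set h {..<n}) \<longlongrightarrow> 0 - 0) (at 0 within rn n)"
      using g g' unfolding has_gradient_def by (intro tendsto_diff) auto
    then have "((\<lambda>h. rn_inner n d h / L2_set h {..<n}) \<longlongrightarrow> 0) (at 0 within rn n)"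
      by (simp add: d_def rn_inner_simps flip: diff_divide_distrib)
    moreover have "filterlim (\<lambda>s. s *\<^sub>R d) (at 0 within rn n) (at_right (0::real))"
      unfolding filterlim_at
    proof
      show "\<forall>\<^sub>F s in at_right 0. s *\<^sub>R d \<in> rn n \<and> s *\<^sub>R d \<noteq> 0"
        using rn_closed(4)[OF d] \<open>d \<noteq> 0\<close> by (simp add: eventually_at_filter)
      have "continuous_on UNIV (\<lambda>s::real. s *\<^sub>R d)"
        unfolding scaleR_fun_def by (intro continuous_intros)
      then have "((\<lambda>s::real. s *\<^sub>R d) \<longlongrightarrow> 0 *\<^sub>R d) (at 0)"
        unfolding continuous_on_def by blast
      then show "((\<lambda>s::real. s *\<^sub>R d) \<longlongrightarrow> 0) (at_right 0)"
        unfolding scaleR_zero_left filterlim_at_split by blast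
    qed
    ultimately have "((\<lambda>s. rn_inner n d (s *\<^sub>R d) / L2_set (s *\<^sub>R d) {..<n}) \<longlongrightarrow> 0) (at_right 0)"
      by (rule filterlim_compose)
    moreover have "\<forall>\<^sub>F s in at_right 0. rn_inner n d (s *\<^sub>R d) / L2_set (s *\<^sub>R d) {..<n} = L2_set d {..<n}"
      using pos by (auto simp: eventually_at_filter L2_set_scaleR rn_inner_simps power2_eq_square
          simp flip: L2_set_power2)
    ultimately have "((\<lambda>s::real. L2_set d {..<n}) \<longlongrightarrow> 0) (at_right 0)"
      using tendsto_cong by force
    then have "L2_set d {..<n} = 0"
      by (simp add: tendsto_const_iff)
    with pos show False by simp
  qed
qed

lemma has_gradient_if_quadratic_bounds:
  assumes g: "g \<in> rn n"
    and lower: "\<And>h. h \<in> rn n \<Longrightarrow> F x + rn_inner n g h \<le> F (x + h)"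
    and upper: "\<And>h. h \<in> rn n \<Longrightarrow> F (x + h) \<le> F x + rn_inner n g h + c * (L2_set h {..<n})\<^sup>2"
  shows "has_gradient n F x g"
  unfolding has_gradient_def
proof (rule conjI[OF g], rule tendsto_sandwich)
  have ge: "0 \<le> (F (x + h) - F x - rn_inner n g h) / L2_set h {..<n}" if "h \<in> rn n" for h
    using lower[OF that] by simp
  have le: "(F (x + h) - F x - rn_inner n g h) / L2_set h {..<n} \<le> c * L2_set h {..<n}"
    if "h \<in> rn n" "h \<noteq> 0" for h
  proof (cases "L2_set h {..<n} = 0")
    case False
    then have "L2_set h {..<n} > 0"
      by (simp add: less_le)
    then show ?thesis
      using upper[OF that(1)] by (simp add: divide_simps power2_eq_square)
  qed simp
  show "\<forall>\<^sub>F h in at 0 within rn n. 0 \<le> (F (x + h) - F x - rn_inner n g h) / L2_set h {..<n}"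
    using ge by (auto simp: eventually_at_filter)
  show "\<forall>\<^sub>F h in at 0 within rn n.
      (F (x + h) - F x - rn_inner n g h) / L2_set h {..<n} \<le> c * L2_set h {..<n}"
    using le by (auto simp: eventually_at_filter)
  have "continuous_on (rn n) (\<lambda>h. c * L2_set h {..<n})"
    by (intro continuous_intros)
  then have "((\<lambda>h. c * L2_set h {..<n}) \<longlongrightarrow> c * L2_set (0::nat \<Rightarrow> real) {..<n}) (at 0 within rn n)"
    using rn_closed(1) unfolding continuous_on_def by blast
  then show "((\<lambda>h. c * L2_set h {..<n}) \<longlongrightarrow> 0) (at 0 within rn n)"
    by (simp add: L2_set_0')
qed simp

section \<open>The Moreau envelope of a convex Lipschitz function\<close>

text \<open>Everything about \<open>f\<close> that the convergence proof uses; Lipschitz refers to the Euclidean norm.\<close>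

locale convex_lipschitz_rn =
  fixes n :: nat and f :: "(nat \<Rightarrow> real) \<Rightarrow> real" and G :: real
  assumes convex_f: "convex_on (rn n) f"
    and G_nonneg: "0 \<le> G"
    and lipschitz: "x \<in> rn n \<Longrightarrow> y \<in> rn n \<Longrightarrow> f x - f y \<le> G * L2_set (x - y) {..<n}"
begin

definition is_prox :: "real \<Rightarrow> (nat \<Rightarrow> real) \<Rightarrow> (nat \<Rightarrow> real) \<Rightarrow> bool"
  where "is_prox \<beta> x p \<longleftrightarrow> p \<in> rn n \<and>
    (\<forall>y\<in>rn n. f p + 1 / (2 * \<beta>) * (L2_set (x - p) {..<n})\<^sup>2 \<le>
       f y + 1 / (2 * \<beta>) * (L2_set (x - y) {..<n})\<^sup>2)"

lemma continuous_on_f: "continuous_on (rn n) f"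
  unfolding continuous_on_def
proof
  fix a assume a: "a \<in> rn n"
  have "continuous_on (rn n) (\<lambda>y. G * L2_set (y - a) {..<n})"
    by (intro continuous_intros continuous_on_L2_set continuous_on_diff_fun)
  then have "((\<lambda>y. G * L2_set (y - a) {..<n}) \<longlongrightarrow> G * L2_set (a - a) {..<n}) (at a within rn n)"
    using a unfolding continuous_on_def by blast
  then have lim: "((\<lambda>y. G * L2_set (y - a) {..<n}) \<longlongrightarrow> 0) (at a within rn n)"
    by (simp add: L2_set_0')
  have "\<bar>f y - f a\<bar> \<le> G * L2_set (y - a) {..<n}" if "y \<in> rn n" for y
    using lipschitz[OF that a] lipschitz[OF a that] by (simp add: L2_set_minus_commute)
  then have "((\<lambda>y. f y - f a) \<longlongrightarrow> 0) (at a within rn n)"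
    by (intro Lim_null_comparison[OF _ lim]) (auto simp: eventually_at_filter)
  then show "(f \<longlongrightarrow> f a) (at a within rn n)"
    by (rule LIM_zero_cancel)
qed

text \<open>
  Where \<open>\<parallel>x - y\<parallel> > 2 \<beta> G\<close>, the quadratic penalty exceeds the at most linear decrease of \<open>f\<close>, and the
  objective is no smaller than at \<open>x\<close>. Hence its minimum over a box of radius \<open>2 \<beta> G\<close> is global.
\<close>

lemma ex_prox:
  assumes x: "x \<in> rn n" and \<beta>: "\<beta> > 0"
  shows "\<exists>p. is_prox \<beta> x p"
proof -
  define \<psi> where "\<psi> y = f y + 1 / (2 * \<beta>) * (L2_set (x - y) {..<n})\<^sup>2" for y
  define R where "R = 2 * \<beta> * G"
  define B where "B = {y. \<forall>i. y i \<in> (if i < n then cball (x i) R else {0})}"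
  have R: "R \<ge> 0"
    using \<beta> G_nonneg by (simp add: R_def)
  have sub: "B \<subseteq> rn n"
  proof
    fix y assume "y \<in> B"
    then have "y i \<in> (if i < n then cball (x i) R else {0})" for i
      unfolding B_def by blast
    then have "y i = 0" if "i \<ge> n" for i
      using that by (metis leD singletonD)
    then show "y \<in> rn n"
      by (simp add: topspace_Euclidean_space)
  qed
  have xB: "x \<in> B"
    using x R by (auto simp: B_def topspace_Euclidean_space)
  have "continuous_on B \<psi>"
    unfolding \<psi>_def
    by (intro continuous_intros continuous_on_subset[OF continuous_on_f sub]
        continuous_on_L2_set continuous_on_diff_fun)
  then obtain p where p: "p \<in> B" and min: "\<And>y. y \<in> B \<Longrightarrow> \<psi> p \<le> \<psi> y"
    using continuous_attains_inf[of B \<psi>] compact_box_rn[of n x R] xB unfolding B_def by blast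
  have "\<psi> p \<le> \<psi> y" if y: "y \<in> rn n" for y
  proof (cases "y \<in> B")
    case False
    define r where "r = L2_set (x - y) {..<n}"
    obtain i where i: "i < n" "\<bar>x i - y i\<bar> > R"
      using False y unfolding B_def topspace_Euclidean_space mem_Collect_eq
      by (metis dist_real_def linorder_not_less mem_cball singletonI)
    have "\<bar>x i - y i\<bar> \<le> L2_set (\<lambda>i. \<bar>x i - y i\<bar>) {..<n}"
      using i by (intro member_le_L2_set[of "{..<n}" i "\<lambda>i. \<bar>x i - y i\<bar>"]) auto
    also have "\<dots> = r"
      by (simp add: r_def L2_set_def)
    finally have r: "r > R"
      using i by simp
    have "\<psi> p \<le> \<psi> x"
      by (rule min[OF xB])
    also have "\<psi> x = f x"
      by (simp add: \<psi>_def L2_set_0')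
    also have "f x \<le> f y + G * r"
      using lipschitz[OF x y] by (simp add: r_def)
    also have "G * r \<le> 1 / (2 * \<beta>) * r\<^sup>2"
      using mult_right_mono[of R r r] r R \<beta> by (simp add: R_def field_simps power2_eq_square)
    finally show ?thesis
      by (simp add: \<psi>_def r_def)
  qed (rule min)
  then show ?thesis
    using p sub unfolding is_prox_def \<psi>_def by blast
qed

lemma moreau_envelope_prox:
  assumes "is_prox \<beta> x p"
  shows "moreau_envelope n f \<beta> x = f p + 1 / (2 * \<beta>) * (L2_set (x - p) {..<n})\<^sup>2"
  using assms unfolding moreau_envelope_def is_prox_def
  by (intro cInf_eq_minimum) auto

lemma moreau_envelope_le:
  assumes "x \<in> rn n" "\<beta> > 0" "y \<in> rn n"
  shows "moreau_envelope n f \<beta> x \<le> f y + 1 / (2 * \<beta>) * (L2_set (x - y) {..<n})\<^sup>2"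
  using ex_prox[OF assms(1,2)] assms(3) by (metis is_prox_def moreau_envelope_prox)

lemma moreau_envelope_le_self:
  assumes "x \<in> rn n" "\<beta> > 0"
  shows "moreau_envelope n f \<beta> x \<le> f x"
  using moreau_envelope_le[OF assms assms(1)] by (simp add: L2_set_0')

text \<open>
  Move from \<open>p\<close> towards \<open>z\<close> by a fraction \<open>s\<close>. Minimality of \<open>p\<close> and convexity of \<open>f\<close> give the claimed
  inequality up to an error proportional to \<open>s\<close>, which disappears in the limit.
\<close>

lemma prox_subgradient:
  assumes p: "is_prox \<beta> x p" and \<beta>: "\<beta> > 0" and z: "z \<in> rn n"
  shows "f p + rn_inner n (x - p) (z - p) / \<beta> \<le> f z"
proof -
  have p_rn: "p \<in> rn n"
    using p by (simp add: is_prox_def)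
  let ?a = "rn_inner n (x - p) (z - p) / \<beta> - (f z - f p)"
  let ?b = "1 / (2 * \<beta>) * rn_inner n (z - p) (z - p)"
  have bound: "?a \<le> s * ?b" if s: "0 < s" "s < 1" for s
  proof -
    let ?y = "(1 - s) *\<^sub>R p + s *\<^sub>R z"
    have y: "?y \<in> rn n"
      by (intro rn_closed p_rn z)
    define N where "N = rn_inner n (x - p) (x - p)"
    define c where "c = rn_inner n (x - p) (z - p)"
    define d where "d = rn_inner n (z - p) (z - p)"
    have min: "f p + 1 / (2 * \<beta>) * N \<le> f ?y + 1 / (2 * \<beta>) * rn_inner n (x - ?y) (x - ?y)"
      using p y by (simp add: is_prox_def N_def L2_set_power2)
    have conv: "f ?y \<le> (1 - s) * f p + s * f z"
      using s by (intro convex_onD[OF convex_f] p_rn z) auto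
    have square: "rn_inner n (u - s *\<^sub>R w) (u - s *\<^sub>R w)
        = rn_inner n u u - 2 * s * rn_inner n u w + s * s * rn_inner n w w" for u w
      by (simp add: rn_inner_simps rn_inner_commute[of n w u] algebra_simps)
    have "x - ?y = (x - p) - s *\<^sub>R (z - p)"
      by (simp add: algebra_simps)
    then have "rn_inner n (x - ?y) (x - ?y) = N - 2 * s * c + s * s * d"
      by (simp only: square N_def c_def d_def)
    with min conv have "f p + 1 / (2 * \<beta>) * N
        \<le> (1 - s) * f p + s * f z + 1 / (2 * \<beta>) * (N - 2 * s * c + s * s * d)"
      by simp
    then have "s * (c / \<beta> - (f z - f p)) \<le> s * (s * (1 / (2 * \<beta>) * d))"
      using \<beta> by (simp add: field_simps)
    then show ?thesis
      unfolding c_def d_def using mult_le_cancel_left_pos[OF s(1)] by blast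
  qed
  have "((\<lambda>s. s * ?b) \<longlongrightarrow> 0 * ?b) (at_right 0)"
    by (intro tendsto_intros)
  moreover have "\<forall>\<^sub>F s in at_right 0. ?a \<le> s * ?b"
    using eventually_at_right_less[of 0] eventually_at_right_real[of 0 1] bound
    by (auto elim!: eventually_mono)
  ultimately have "?a \<le> 0 * ?b"
    by (intro tendsto_lowerbound) auto
  then show ?thesis
    by simp
qed

text \<open>The subgradient inequality between \<open>p\<close> and \<open>x\<close> reads \<open>r\<^sup>2 / \<beta> \<le> f x - f p \<le> G r\<close> for \<open>r = \<parallel>x - p\<parallel>\<close>.\<close>

lemma L2_set_prox_le:
  assumes p: "is_prox \<beta> x p" and \<beta>: "\<beta> > 0" and x: "x \<in> rn n"
  shows "L2_set (x - p) {..<n} \<le> \<beta> * G"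
proof -
  have p_rn: "p \<in> rn n"
    using p by (simp add: is_prox_def)
  define r where "r = L2_set (x - p) {..<n}"
  have "r\<^sup>2 / \<beta> \<le> G * r"
    using prox_subgradient[OF p \<beta> x] lipschitz[OF x p_rn] by (simp add: r_def L2_set_power2)
  then have "r * r \<le> r * (\<beta> * G)"
    using \<beta> by (simp add: field_simps power2_eq_square)
  moreover have "0 \<le> r"
    by (simp add: r_def)
  ultimately have "r \<le> \<beta> * G"
    using \<beta> G_nonneg mult_le_cancel_left_pos[of r r "\<beta> * G"]
    by (cases "r = 0") simp_all
  then show ?thesis
    by (simp add: r_def)
qed

lemma self_le_moreau_envelope:
  assumes x: "x \<in> rn n" and \<beta>: "\<beta> > 0"
  shows "f x \<le> moreau_envelope n f \<beta> x + \<beta> * G\<^sup>2 / 2"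
proof -
  obtain p where p: "is_prox \<beta> x p"
    using ex_prox[OF x \<beta>] by blast
  define r where "r = L2_set (x - p) {..<n}"
  have "f x \<le> f p + G * r"
    using lipschitz[OF x, of p] p by (simp add: is_prox_def r_def)
  also have "G * r \<le> 1 / (2 * \<beta>) * r\<^sup>2 + \<beta> * G\<^sup>2 / 2"
    using zero_le_power2[of "r - \<beta> * G"] \<beta> by (simp add: field_simps power2_eq_square)
  finally show ?thesis
    by (simp add: moreau_envelope_prox[OF p] r_def)
qed

text \<open>
  For the lower bound, let \<open>q\<close> be a proximal point of \<open>y\<close>. The gap between the two sides is the gap of
  the subgradient inequality from \<open>p\<close> to \<open>q\<close> plus \<open>\<parallel>(y - q) - (x - p)\<parallel>\<^sup>2 / (2 \<beta>)\<close>. For the upper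
  bound, use \<open>p\<close> as a competitor in the minimization that defines the envelope at \<open>y\<close>; expanding
  \<open>\<parallel>y - p\<parallel>\<^sup>2\<close> gives the right-hand side exactly.
\<close>

lemma moreau_envelope_quadratic_bounds:
  assumes p: "is_prox \<beta> x p" and \<beta>: "\<beta> > 0" and y: "y \<in> rn n"
  defines "g \<equiv> (1 / \<beta>) *\<^sub>R (x - p)"
  shows "moreau_envelope n f \<beta> x + rn_inner n g (y - x) \<le> moreau_envelope n f \<beta> y"
    and "moreau_envelope n f \<beta> y \<le>
      moreau_envelope n f \<beta> x + rn_inner n g (y - x) + 1 / (2 * \<beta>) * (L2_set (y - x) {..<n})\<^sup>2"
proof -
  have p_rn: "p \<in> rn n"
    using p by (simp add: is_prox_def)
  obtain q where q: "is_prox \<beta> y q"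
    using ex_prox[OF y \<beta>] by blast
  have "f p + rn_inner n (x - p) (q - p) / \<beta> \<le> f q"
    using q by (intro prox_subgradient[OF p \<beta>]) (simp add: is_prox_def)
  moreover have "0 \<le> (L2_set ((y - q) - (x - p)) {..<n})\<^sup>2 / (2 * \<beta>)"
    using \<beta> by simp
  moreover have "moreau_envelope n f \<beta> y - moreau_envelope n f \<beta> x - rn_inner n g (y - x)
      = (f q - f p - rn_inner n (x - p) (q - p) / \<beta>) + (L2_set ((y - q) - (x - p)) {..<n})\<^sup>2 / (2 * \<beta>)"
    using \<beta> unfolding moreau_envelope_prox[OF p] moreau_envelope_prox[OF q] g_def L2_set_power2
    by (simp add: rn_inner_simps rn_inner_commute[of n p x] rn_inner_commute[of n q x]
        rn_inner_commute[of n q p] rn_inner_commute[of n y x] rn_inner_commute[of n y p]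
        rn_inner_commute[of n q y] field_simps)
  ultimately show "moreau_envelope n f \<beta> x + rn_inner n g (y - x) \<le> moreau_envelope n f \<beta> y"
    by linarith
  have "moreau_envelope n f \<beta> y \<le> f p + 1 / (2 * \<beta>) * (L2_set (y - p) {..<n})\<^sup>2"
    by (rule moreau_envelope_le[OF y \<beta> p_rn])
  also have "\<dots> = moreau_envelope n f \<beta> x + rn_inner n g (y - x)
      + 1 / (2 * \<beta>) * (L2_set (y - x) {..<n})\<^sup>2"
    using \<beta> unfolding moreau_envelope_prox[OF p] g_def L2_set_power2
    by (simp add: rn_inner_simps rn_inner_commute[of n p x] rn_inner_commute[of n y x]
        rn_inner_commute[of n y p] field_simps)
  finally show "moreau_envelope n f \<beta> y \<le>
      moreau_envelope n f \<beta> x + rn_inner n g (y - x) + 1 / (2 * \<beta>) * (L2_set (y - x) {..<n})\<^sup>2" .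
qed

lemma gradient_moreau_envelope:
  assumes p: "is_prox \<beta> x p" and \<beta>: "\<beta> > 0" and x: "x \<in> rn n"
  shows "gradient n (moreau_envelope n f \<beta>) x = (1 / \<beta>) *\<^sub>R (x - p)"
proof (intro gradient_eqI has_gradient_if_quadratic_bounds)
  show "(1 / \<beta>) *\<^sub>R (x - p) \<in> rn n"
    using p x by (intro rn_closed) (simp_all add: is_prox_def)
  fix h assume h: "h \<in> rn n"
  show "moreau_envelope n f \<beta> x + rn_inner n ((1 / \<beta>) *\<^sub>R (x - p)) h \<le> moreau_envelope n f \<beta> (x + h)"
    "moreau_envelope n f \<beta> (x + h) \<le> moreau_envelope n f \<beta> x
      + rn_inner n ((1 / \<beta>) *\<^sub>R (x - p)) h + 1 / (2 * \<beta>) * (L2_set h {..<n})\<^sup>2"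
    using moreau_envelope_quadratic_bounds[OF p \<beta> rn_closed(2)[OF x h]] by simp_all
qed

text \<open>
  The proximal point for the larger parameter is a competitor for the smaller one; it pays
  \<open>\<parallel>x - p\<parallel>\<^sup>2 (1 / (2 \<beta>') - 1 / (2 \<beta>))\<close> more, and \<open>\<parallel>x - p\<parallel> \<le> \<beta> G\<close>.
\<close>

lemma moreau_envelope_decrease_parameter:
  assumes x: "x \<in> rn n" and \<beta>': "0 < \<beta>'" and le: "\<beta>' \<le> \<beta>"
  shows "moreau_envelope n f \<beta>' x \<le> moreau_envelope n f \<beta> x + G\<^sup>2 * \<beta> * (\<beta> - \<beta>') / (2 * \<beta>')"
proof -
  have \<beta>: "\<beta> > 0"
    using \<beta>' le by simp
  obtain p where p: "is_prox \<beta> x p"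
    using ex_prox[OF x \<beta>] by blast
  define r where "r = L2_set (x - p) {..<n}"
  have "r\<^sup>2 \<le> (\<beta> * G)\<^sup>2"
    unfolding r_def by (intro power_mono L2_set_prox_le[OF p \<beta> x]) simp
  then have "(1 / (2 * \<beta>') - 1 / (2 * \<beta>)) * r\<^sup>2 \<le> (1 / (2 * \<beta>') - 1 / (2 * \<beta>)) * (\<beta> * G)\<^sup>2"
    using le \<beta>' \<beta> by (intro mult_left_mono) (auto simp: field_simps)
  also have "\<dots> = G\<^sup>2 * \<beta> * (\<beta> - \<beta>') / (2 * \<beta>')"
    using \<beta> \<beta>' by (simp add: field_simps power2_eq_square)
  finally have "1 / (2 * \<beta>') * r\<^sup>2 \<le> 1 / (2 * \<beta>) * r\<^sup>2 + G\<^sup>2 * \<beta> * (\<beta> - \<beta>') / (2 * \<beta>')"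
    by (simp add: left_diff_distrib)
  moreover have "moreau_envelope n f \<beta>' x \<le> f p + 1 / (2 * \<beta>') * r\<^sup>2"
    using p unfolding r_def by (intro moreau_envelope_le[OF x \<beta>']) (simp add: is_prox_def)
  ultimately show ?thesis
    by (simp add: moreau_envelope_prox[OF p] r_def)
qed

end

section \<open>Convergence of hybrid conditional gradient-smoothing\<close>

lemma compactin_Euclidean_spaceD:
  assumes "compactin (Euclidean_space n) C"
  shows "compact C" and "C \<subseteq> rn n"
  using assms
  by (auto simp: Euclidean_space_def compactin_subtopology euclidean_product_topology
      topspace_Euclidean_space dest: compactin_subset_topspace)

text \<open>
  At \<open>t = 0\<close> the factor \<open>1 - 2 / (t + 2)\<close> vanishes, so that the conclusion is independent of \<open>h 0\<close>.
  With \<open>s = t + 3\<close>, the induction step reduces to \<open>(s - 2) \<surd>s \<le> (s - 1) \<surd>(s - 1)\<close>, whose square says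
  \<open>0 \<le> s\<^sup>2 - s - 1\<close>.
\<close>

lemma le_inverse_sqrt_if_recursion:
  fixes h :: "nat \<Rightarrow> real"
  assumes A: "A \<ge> 0"
    and rec: "\<And>t. h (Suc t) \<le> (1 - 2 / (real t + 2)) * h t + A / ((real t + 2) * sqrt (real t + 2))"
  shows "h (Suc t) \<le> A / sqrt (real t + 2)"
proof (induction t)
  case 0
  have "h (Suc 0) \<le> A / (2 * sqrt 2)"
    using rec[of 0] by simp
  also have "\<dots> \<le> A / sqrt 2"
    using A by (intro divide_left_mono) auto
  finally show ?case by simp
next
  case (Suc t)
  define s where "s = real t + 3"
  have s: "s \<ge> 3"
    by (simp add: s_def)
  have "(s - 2) * sqrt s \<le> (s - 1) * sqrt (s - 1)"
  proof (rule power2_le_imp_le)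
    have "0 \<le> s * (s - 1) - 1"
      using mult_mono[of 3 s 2 "s - 1"] s by simp
    then show "((s - 2) * sqrt s)\<^sup>2 \<le> ((s - 1) * sqrt (s - 1))\<^sup>2"
      using s by (simp add: power_mult_distrib) (simp add: power2_eq_square algebra_simps)
  qed (use s in simp)
  then have key: "(s - 2) / sqrt (s - 1) \<le> (s - 1) / sqrt s"
    using s by (simp add: divide_simps mult.commute)
  have "h (Suc (Suc t)) \<le> (1 - 2 / s) * h (Suc t) + A / (s * sqrt s)"
    using rec[of "Suc t"] by (simp add: s_def add.commute)
  also have "(1 - 2 / s) * h (Suc t) \<le> (1 - 2 / s) * (A / sqrt (s - 1))"
    using Suc s by (intro mult_left_mono) (simp_all add: s_def add.commute)
  also have "\<dots> = A / s * ((s - 2) / sqrt (s - 1))"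
    using s by (simp add: field_simps)
  also have "\<dots> \<le> A / s * ((s - 1) / sqrt s)"
    using A s by (intro mult_left_mono key) simp
  also have "\<dots> + A / (s * sqrt s) = A / sqrt s"
    using s by (simp add: field_simps)
  finally show ?case
    by (simp add: s_def add.commute)
qed

context convex_lipschitz_rn
begin

text \<open>
  The usual conditional gradient estimate for the smooth convex function \<open>F \<beta>\<close>, except that progress
  is measured against \<open>f y\<close>, which is at least the envelope at \<open>y\<close>. The comparison with \<open>f y\<close> remains
  meaningful when \<open>\<beta>\<close> changes.
\<close>

lemma hcgs_step:
  assumes \<beta>: "\<beta> > 0" and \<gamma>: "\<gamma> \<ge> 0"
    and x: "x \<in> rn n" and v: "v \<in> rn n" and y: "y \<in> rn n"
    and min: "rn_inner n v (gradient n (moreau_envelope n f \<beta>) x)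
      \<le> rn_inner n y (gradient n (moreau_envelope n f \<beta>) x)"
    and D: "L2_set (v - x) {..<n} \<le> D"
  shows "moreau_envelope n f \<beta> (x + \<gamma> *\<^sub>R (v - x)) - f y
    \<le> (1 - \<gamma>) * (moreau_envelope n f \<beta> x - f y) + \<gamma>\<^sup>2 * D\<^sup>2 / (2 * \<beta>)"
proof -
  obtain p where p: "is_prox \<beta> x p"
    using ex_prox[OF x \<beta>] by blast
  define g where "g = (1 / \<beta>) *\<^sub>R (x - p)"
  have grad: "gradient n (moreau_envelope n f \<beta>) x = g"
    unfolding g_def by (rule gradient_moreau_envelope[OF p \<beta> x])
  have "rn_inner n g (v - x) \<le> rn_inner n g (y - x)"
    using min by (simp add: grad rn_inner_simps rn_inner_commute[of n g])
  also have "\<dots> \<le> moreau_envelope n f \<beta> y - moreau_envelope n f \<beta> x"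
    using moreau_envelope_quadratic_bounds(1)[OF p \<beta> y] by (simp add: g_def)
  also have "\<dots> \<le> f y - moreau_envelope n f \<beta> x"
    using moreau_envelope_le_self[OF y \<beta>] by simp
  finally have "\<gamma> * rn_inner n g (v - x) \<le> \<gamma> * (f y - moreau_envelope n f \<beta> x)"
    using \<gamma> by (intro mult_left_mono)
  moreover have "moreau_envelope n f \<beta> (x + \<gamma> *\<^sub>R (v - x))
      \<le> moreau_envelope n f \<beta> x + \<gamma> * rn_inner n g (v - x)
        + 1 / (2 * \<beta>) * (\<bar>\<gamma>\<bar> * L2_set (v - x) {..<n})\<^sup>2"
    using moreau_envelope_quadratic_bounds(2)[OF p \<beta>, of "x + \<gamma> *\<^sub>R (v - x)"]
    by (simp add: rn_closed x v g_def L2_set_scaleR rn_inner_simps(6))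
  moreover have "1 / (2 * \<beta>) * (\<bar>\<gamma>\<bar> * L2_set (v - x) {..<n})\<^sup>2 \<le> 1 / (2 * \<beta>) * (\<bar>\<gamma>\<bar> * D)\<^sup>2"
    using \<beta> D by (intro mult_left_mono power_mono) simp_all
  ultimately show ?thesis
    by (simp add: power_mult_distrib algebra_simps)
qed

text \<open>
  The general cost \<open>G\<^sup>2 \<beta> (\<beta> - \<beta>') / (2 \<beta>')\<close> equals \<open>G\<^sup>2 D (\<surd>(s + 1) - \<surd>s) / s\<close> here, and
  \<open>\<surd>(s + 1) - \<surd>s \<le> 1 / \<surd>s\<close>.
\<close>

lemma moreau_envelope_next_parameter:
  assumes x: "x \<in> rn n" and D: "D > 0" and s: "s > 0"
  shows "moreau_envelope n f (2 * D / sqrt (s + 1)) x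
    \<le> moreau_envelope n f (2 * D / sqrt s) x + G\<^sup>2 * D / (s * sqrt s)"
proof -
  define a where "a = sqrt s"
  define b where "b = sqrt (s + 1)"
  have a: "a > 0" and ab: "a \<le> b" and a2: "a * a = s" and b2: "b * b = s + 1"
    using s by (simp_all add: a_def b_def)
  have "a * (b - a) \<le> (b + a) * (b - a)"
    using a ab by (intro mult_right_mono) simp_all
  also have "\<dots> = 1"
    using a2 b2 by (simp add: algebra_simps)
  finally have diff: "b - a \<le> 1 / a"
    using a by (simp add: field_simps)
  have "moreau_envelope n f (2 * D / b) x \<le> moreau_envelope n f (2 * D / a) x
      + G\<^sup>2 * (2 * D / a) * (2 * D / a - 2 * D / b) / (2 * (2 * D / b))"
    using D a ab by (intro moreau_envelope_decrease_parameter[OF x] divide_left_mono) simp_all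
  also have "G\<^sup>2 * (2 * D / a) * (2 * D / a - 2 * D / b) / (2 * (2 * D / b)) = G\<^sup>2 * D / (a * a) * (b - a)"
    using D a ab by (simp add: field_simps)
  also have "\<dots> \<le> G\<^sup>2 * D / (a * a) * (1 / a)"
    using D a by (intro mult_left_mono diff) simp
  finally show ?thesis
    using a2 by (simp add: a_def b_def)
qed

lemma hcgs_iterate_in:
  assumes C: "convex C"
    and \<gamma>: "\<And>t. \<gamma> t = 2 / (real t + 2)"
    and run: "hcgs_run n C f \<gamma> \<beta> x v"
  shows "x t \<in> C"
proof (induction t)
  case 0
  show ?case
    using run by (simp add: hcgs_run_def extreme_point_of_def)
next
  case (Suc t)
  have "v t \<in> C"
    using run by (simp add: hcgs_run_def extreme_point_of_def)
  then have "(1 - \<gamma> t) *\<^sub>R x t + \<gamma> t *\<^sub>R v t \<in> C"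
    using Suc C by (intro convexD) (simp_all add: \<gamma>)
  also have "(1 - \<gamma> t) *\<^sub>R x t + \<gamma> t *\<^sub>R v t = x (Suc t)"
    using run by (simp add: hcgs_run_def algebra_simps)
  finally show ?case .
qed

lemma hcgs_convergence:
  assumes comp: "compactin (Euclidean_space n) C" and conv: "convex C"
    and D: "D = l2_diameter n C" "D > 0"
    and y: "y \<in> C"
    and \<gamma>: "\<And>t. \<gamma> t = 2 / (real t + 2)"
    and \<beta>: "\<And>t. \<beta> t = 2 * D / sqrt (real t + 2)"
    and run: "hcgs_run n C f \<gamma> \<beta> x v"
  shows "f (x (Suc t)) - f y \<le> (1 + 2 * G\<^sup>2) * D / sqrt (real t + 2)"
proof -
  note C = compactin_Euclidean_spaceD[OF comp]
  have xC: "x t \<in> C" for t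
    by (rule hcgs_iterate_in[OF conv \<gamma> run])
  have vC: "v t \<in> C" for t
    using run by (simp add: hcgs_run_def extreme_point_of_def)
  have \<beta>_pos: "\<beta> t > 0" for t
    using D by (simp add: \<beta>)
  define h where "h t = moreau_envelope n f (\<beta> t) (x t) - f y" for t
  have "h (Suc t) \<le> (1 - 2 / (real t + 2)) * h t + (1 + G\<^sup>2) * D / ((real t + 2) * sqrt (real t + 2))" for t
  proof -
    define s where "s = real t + 2"
    have s: "s > 0"
      by (simp add: s_def)
    have "moreau_envelope n f (\<beta> (Suc t)) (x (Suc t))
        \<le> moreau_envelope n f (\<beta> t) (x (Suc t)) + G\<^sup>2 * D / (s * sqrt s)"
      using moreau_envelope_next_parameter[of "x (Suc t)" D s] xC C(2) D s
      by (auto simp: \<beta> s_def add.commute add.left_commute)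
    moreover have "moreau_envelope n f (\<beta> t) (x t + \<gamma> t *\<^sub>R (v t - x t)) - f y
        \<le> (1 - \<gamma> t) * (moreau_envelope n f (\<beta> t) (x t) - f y) + (\<gamma> t)\<^sup>2 * D\<^sup>2 / (2 * \<beta> t)"
    proof (rule hcgs_step[OF \<beta>_pos])
      show "rn_inner n (v t) (gradient n (moreau_envelope n f (\<beta> t)) (x t))
          \<le> rn_inner n y (gradient n (moreau_envelope n f (\<beta> t)) (x t))"
        using run y by (auto simp: hcgs_run_def is_arg_min_linorder)
      show "L2_set (v t - x t) {..<n} \<le> D"
        unfolding D(1) by (rule L2_set_le_l2_diameter[OF C(1) vC xC])
    qed (use C(2) xC vC y in \<open>auto simp: \<gamma>\<close>)
    moreover have "(\<gamma> t)\<^sup>2 * D\<^sup>2 / (2 * \<beta> t) = D / (s * sqrt s)"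
      using D s by (simp add: \<gamma> \<beta> power2_eq_square field_simps flip: s_def)
    moreover have "x (Suc t) = x t + \<gamma> t *\<^sub>R (v t - x t)"
      using run by (simp add: hcgs_run_def)
    ultimately show ?thesis
      by (simp add: h_def \<gamma> add_divide_distrib distrib_right flip: s_def)
  qed
  then have "h (Suc t) \<le> (1 + G\<^sup>2) * D / sqrt (real t + 2)"
    using D by (intro le_inverse_sqrt_if_recursion) simp
  moreover have "f (x (Suc t)) \<le> h (Suc t) + f y + \<beta> (Suc t) * G\<^sup>2 / 2"
    using self_le_moreau_envelope[of "x (Suc t)" "\<beta> (Suc t)"] xC C(2) \<beta>_pos
    by (auto simp: h_def)
  moreover have "\<beta> (Suc t) * G\<^sup>2 / 2 \<le> D * G\<^sup>2 / sqrt (real t + 2)"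
    using D by (simp add: \<beta> frac_le)
  ultimately show ?thesis
    by (simp add: add_divide_distrib distrib_right distrib_left mult.commute)
qed

end

section \<open>The maximum norm and sparsity\<close>

lemma abs_le_linf_norm: "i < n \<Longrightarrow> \<bar>x i\<bar> \<le> linf_norm n x"
  unfolding linf_norm_def by (intro Max_ge) auto

lemma linf_norm_leI:
  assumes "n > 0" and "\<And>i. i < n \<Longrightarrow> \<bar>x i\<bar> \<le> c"
  shows "linf_norm n x \<le> c"
  using assms unfolding linf_norm_def by (subst Max_le_iff) auto

lemma linf_norm_diff_le_L2_set:
  assumes "n > 0"
  shows "linf_norm n x - linf_norm n y \<le> L2_set (x - y) {..<n}"
proof -
  have "linf_norm n x \<le> linf_norm n y + L2_set (x - y) {..<n}"
  proof (rule linf_norm_leI[OF assms])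
    fix i assume i: "i < n"
    have "\<bar>x i - y i\<bar> \<le> L2_set (\<lambda>i. \<bar>x i - y i\<bar>) {..<n}"
      using i by (intro member_le_L2_set[of "{..<n}" i "\<lambda>i. \<bar>x i - y i\<bar>"]) auto
    also have "\<dots> = L2_set (x - y) {..<n}"
      by (simp add: L2_set_def)
    finally show "\<bar>x i\<bar> \<le> linf_norm n y + L2_set (x - y) {..<n}"
      using abs_le_linf_norm[OF i, of y] by linarith
  qed
  then show ?thesis by simp
qed

lemma convex_on_linf_norm_diff:
  assumes "n > 0"
  shows "convex_on (rn n) (\<lambda>y. linf_norm n (y - c))"
proof (rule convex_onI)
  fix t :: real and x y :: "nat \<Rightarrow> real"
  assume t: "0 < t" "t < 1"
  show "linf_norm n ((1 - t) *\<^sub>R x + t *\<^sub>R y - c)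
      \<le> (1 - t) * linf_norm n (x - c) + t * linf_norm n (y - c)"
  proof (rule linf_norm_leI[OF assms])
    fix i assume i: "i < n"
    have "((1 - t) *\<^sub>R x + t *\<^sub>R y - c) i = (1 - t) * (x - c) i + t * (y - c) i"
      by (simp add: scaleR_fun_def algebra_simps)
    also have "\<bar>\<dots>\<bar> \<le> (1 - t) * \<bar>(x - c) i\<bar> + t * \<bar>(y - c) i\<bar>"
      using t by (intro order_trans[OF abs_triangle_ineq]) (simp add: abs_mult)
    also have "\<dots> \<le> (1 - t) * linf_norm n (x - c) + t * linf_norm n (y - c)"
      using t by (intro add_mono mult_left_mono abs_le_linf_norm i) auto
    finally show "\<bar>((1 - t) *\<^sub>R x + t *\<^sub>R y - c) i\<bar>
        \<le> (1 - t) * linf_norm n (x - c) + t * linf_norm n (y - c)" .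
  qed
qed (rule convex_rn)

lemma hcgs_cardinality_le: "hcgs_cardinality \<gamma> x0 v t \<le> Suc t"
proof -
  have "hcgs_cardinality \<gamma> x0 v t \<le> card (insert x0 (v ` {..<t}))"
    unfolding hcgs_cardinality_def
    using hcgs_weight_outside[of _ x0 v t \<gamma>] by (intro card_mono) force+
  also have "\<dots> \<le> Suc (card (v ` {..<t}))"
    by (rule card_insert_le_m1) simp_all
  also have "\<dots> \<le> Suc t"
    using card_image_le[of "{..<t}" v] by simp
  finally show ?thesis .
qed

theorem corollary6p6:
  shows "\<exists>K>0::real. \<forall>(n::nat) (C :: (nat \<Rightarrow> real) set) (xstar :: nat \<Rightarrow> real) (\<epsilon>::real)
      (x :: nat \<Rightarrow> nat \<Rightarrow> real) (v :: nat \<Rightarrow> nat \<Rightarrow> real) (D :: real) (\<gamma> :: nat \<Rightarrow> real) (\<beta> :: nat \<Rightarrow> real).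
      compactin (Euclidean_space n) C \<longrightarrow> convex C \<longrightarrow>
      D = l2_diameter n C \<longrightarrow> D > 0 \<longrightarrow> xstar \<in> C \<longrightarrow> \<epsilon> > 0 \<longrightarrow>
      (\<forall>t. \<gamma> t = 2 / (real t + 2)) \<longrightarrow>
      (\<forall>t. \<beta> t = 2 * D / sqrt (real t + 2)) \<longrightarrow>
      hcgs_run n C (\<lambda>y. linf_norm n (y - xstar)) \<gamma> \<beta> x v \<longrightarrow>
      (\<exists>t. x t \<in> C \<and> linf_norm n (x t - xstar) \<le> \<epsilon> \<and>
           real (hcgs_cardinality \<gamma> (x 0) v t) \<le> K * max 1 (D\<^sup>2 / \<epsilon>\<^sup>2))"
proof (rule exI[of _ 12], intro conjI allI impI)
  fix n C and xstar :: "nat \<Rightarrow> real" and \<epsilon> :: real and x v :: "nat \<Rightarrow> nat \<Rightarrow> real"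
    and D :: real and \<gamma> \<beta> :: "nat \<Rightarrow> real"
  assume comp: "compactin (Euclidean_space n) C" and conv: "convex C"
    and D: "D = l2_diameter n C" "D > 0" and xstar: "xstar \<in> C" and \<epsilon>: "\<epsilon> > 0"
    and \<gamma>: "\<forall>t. \<gamma> t = 2 / (real t + 2)" and \<beta>: "\<forall>t. \<beta> t = 2 * D / sqrt (real t + 2)"
    and run: "hcgs_run n C (\<lambda>y. linf_norm n (y - xstar)) \<gamma> \<beta> x v"
  \<comment> \<open>A set of positive diameter excludes \<open>n = 0\<close>, where \<^const>\<open>linf_norm\<close> is a maximum over the empty set.\<close>
  have n: "n > 0"
  proof (rule ccontr)
    assume "\<not> n > 0"
    then have "(\<lambda>(x, y). L2_set (x - y) {..<n}) ` (C \<times> C) = {0}"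
      using xstar by auto
    then have "l2_diameter n C = 0"
      by (simp add: l2_diameter_def)
    with D show False by simp
  qed
  interpret convex_lipschitz_rn n "\<lambda>y. linf_norm n (y - xstar)" 1
  proof
    show "linf_norm n (x - xstar) - linf_norm n (y - xstar) \<le> 1 * L2_set (x - y) {..<n}" for x y
      using linf_norm_diff_le_L2_set[OF n, of "x - xstar" "y - xstar"] by simp
  qed (simp_all add: convex_on_linf_norm_diff n)
  \<comment> \<open>The bound \<open>3 D / \<surd>(t + 2)\<close> is at most \<open>\<epsilon>\<close> once \<open>t \<ge> 9 D\<^sup>2 / \<epsilon>\<^sup>2\<close>. The iterate \<open>t + 1\<close> uses at most
    \<open>t + 2 \<le> 9 D\<^sup>2 / \<epsilon>\<^sup>2 + 3\<close> vertices, whence the constant \<open>12\<close>.\<close>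
  define t where "t = nat \<lceil>9 * (D\<^sup>2 / \<epsilon>\<^sup>2)\<rceil>"
  have t: "9 * (D\<^sup>2 / \<epsilon>\<^sup>2) \<le> real t" "real t \<le> 9 * (D\<^sup>2 / \<epsilon>\<^sup>2) + 1"
    unfolding t_def by (simp_all add: of_nat_ceiling)
  have "linf_norm n (xstar - xstar) = 0"
    using n by (intro antisym linf_norm_leI) (use abs_le_linf_norm[OF n, of "xstar - xstar"] in auto)
  then have "linf_norm n (x (Suc t) - xstar) \<le> 3 * D / sqrt (real t + 2)"
    using hcgs_convergence[OF comp conv D xstar _ _ run, of t] \<gamma> \<beta> by simp
  also have "\<dots> \<le> \<epsilon>"
  proof -
    have "3 * D / \<epsilon> \<le> sqrt (real t + 2)"
      using t(1) by (intro real_le_rsqrt) (simp add: power_divide power_mult_distrib)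
    then show ?thesis
      using \<epsilon> by (simp add: field_simps)
  qed
  finally have close: "linf_norm n (x (Suc t) - xstar) \<le> \<epsilon>" .
  have "real (hcgs_cardinality \<gamma> (x 0) v (Suc t)) \<le> real t + 2"
    using hcgs_cardinality_le[of \<gamma> "x 0" v "Suc t"] by simp
  also have "\<dots> \<le> 12 * max 1 (D\<^sup>2 / \<epsilon>\<^sup>2)"
    using t(2) by linarith
  finally show "\<exists>t. x t \<in> C \<and> linf_norm n (x t - xstar) \<le> \<epsilon> \<and>
      real (hcgs_cardinality \<gamma> (x 0) v t) \<le> 12 * max 1 (D\<^sup>2 / \<epsilon>\<^sup>2)"
    using close hcgs_iterate_in[OF conv _ run, of "Suc t"] \<gamma> by blast
qed simp

end
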